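(* Let $F$ be a field of characteristic different from $2$, and let $(V,b)$ be an anisotropic (symmetric) bilinear space of dimension $n\geqslant 3$ over $F$ such that $\mathrm{SO}(V)$ is projectively simple. Then the spinor norm map $\theta:\mathrm{SO}(V)\rightarrow F^\times/F^{\times2}$ is the trivial map if and only if one of the following holds: $(i)$ $n$ is odd; $(ii)$ $n$ is even and the determinant of $b$ is trivial.
   Context: A bilinear space $(V,b)$ over $F$ is a finite-dimensional $F$-vector space $V$ with a nondegenerate symmetric bilinear form $b$; its quadratic form is $q(x)=b(x,x)$. A vector $u\in V$ is anisotropic if $q(u)\neq 0$; the space $(V,b)$ is anisotropic if every nonzero vector is anisotropic. The determinant of $b$ is the class in $F^\times/F^{\times2}$ of the determinant of a Gram matrix of $b$; it is trivial if this determinant is a square in $F^\times$. $\mathrm{O}(V)$ is the group of isometries of $(V,b)$ and $\mathrm{SO}(V)$ (the rotation group) is its subgroup of elements of determinant $1$. A group is projectively simple if its quotient by its center is a simple group; for $n\geqslant3$ the group $\mathrm{SO}(V)$ is non-abelian, with center $\{\mathrm{id}\}$ if $n$ is odd and $\{\pm\mathrm{id}\}$ if $n$ is even. For an anisotropic vector $u$, the reflection along $u$ is $\tau_u(x)=x-2\frac{b(x,u)}{q(u)}u$. By the Cartan–Dieudonné theorem every $\sigma\in\mathrm{O}(V)$ is a product $\tau_{u_1}\cdots\tau_{u_m}$ with anisotropic $u_i\in V$ and $m\leqslant n$; the spinor norm $\theta(\sigma)$ is the class of $\prod_{i=1}^m q(u_i)$ in $F^\times/F^{\times2}$, which is independent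 of the choice and number of the $u_i$. *)

theory Defs
  imports
    "HOL-Algebra.Coset"
    "Jordan_Normal_Form.Determinant"
begin

section \<open>Groups\<close>

definition group_center :: "('a, 'm) monoid_scheme \<Rightarrow> 'a set" where
  "group_center G =
     {z \<in> carrier G. \<forall>g \<in> carrier G. z \<otimes>\<^bsub>G\<^esub> g = g \<otimes>\<^bsub>G\<^esub> z}"

text \<open>
  The library locale \<open>simple_group\<close> demands \<open>order G > 1\<close>; since the order of an infinite
  group is \<open>0\<close>, it only covers finite groups. The groups considered here are typically infinite.
\<close>

definition is_simple :: "('a, 'm) monoid_scheme \<Rightarrow> bool" where
  "is_simple G \<longleftrightarrow>
     group G \<and> carrier G \<noteq> {\<one>\<^bsub>G\<^esub>} \<and>
     (\<forall>H. H \<lhd> G \<longrightarrow> H = {\<one>\<^bsub>G\<^esub>} \<or> H = carrier G)"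

definition projectively_simple :: "('a, 'm) monoid_scheme \<Rightarrow> bool" where
  "projectively_simple G \<longleftrightarrow> group G \<and> is_simple (G Mod group_center G)"


section \<open>Square classes of a field\<close>

definition units_group :: "'f::field monoid" where
  "units_group = \<lparr>carrier = {a. a \<noteq> 0}, monoid.mult = (*), one = 1\<rparr>"

definition nonzero_squares :: "'f::field set" where
  "nonzero_squares = {a ^ 2 | a. a \<noteq> 0}"

definition square_class_group :: "'f::field set monoid" where
  "square_class_group = units_group Mod nonzero_squares"

definition square_class :: "'f::field \<Rightarrow> 'f set" where
  "square_class a = nonzero_squares #>\<^bsub>units_group\<^esub> a"


section \<open>Bilinear spaces\<close>

text \<open>The underlying vector space is the whole type \<open>'v\<close>, with scalar multiplication \<open>scale\<close>.\<close>

locale bilinear_space = vector_space scale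
  for scale :: "'f::field \<Rightarrow> 'v::ab_group_add \<Rightarrow> 'v" +
  fixes b :: "'v \<Rightarrow> 'v \<Rightarrow> 'f"
  assumes finite_dimensional: "\<exists>B. finite B \<and> span B = UNIV"
    and form_add_left: "b (x + y) z = b x z + b y z"
    and form_scale_left: "b (scale c x) y = c * b x y"
    and form_sym: "b x y = b y x"
    and form_nondegenerate: "(\<And>y. b x y = 0) \<Longrightarrow> x = 0"
begin

definition quadratic_form :: "'v \<Rightarrow> 'f" where
  "quadratic_form x = b x x"

definition anisotropic_vector :: "'v \<Rightarrow> bool" where
  "anisotropic_vector u \<longleftrightarrow> quadratic_form u \<noteq> 0"

definition anisotropic :: bool where
  "anisotropic \<longleftrightarrow> (\<forall>u. u \<noteq> 0 \<longrightarrow> anisotropic_vector u)"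

definition ordered_basis :: "'v list \<Rightarrow> bool" where
  "ordered_basis vs \<longleftrightarrow> distinct vs \<and> independent (set vs) \<and> span (set vs) = UNIV"

definition gram_matrix :: "'v list \<Rightarrow> 'f mat" where
  "gram_matrix vs = mat (length vs) (length vs) (\<lambda>(i, j). b (vs ! i) (vs ! j))"

text \<open>
  The definite descriptions below are well defined because a change of basis multiplies a Gram
  determinant by a nonzero square and does not affect the determinant of an endomorphism.
\<close>

definition form_det :: "'f set" where
  "form_det = (THE c. \<exists>vs. ordered_basis vs \<and> c = square_class (det (gram_matrix vs)))"

definition endo_matrix :: "'v list \<Rightarrow> ('v \<Rightarrow> 'v) \<Rightarrow> 'f mat" where
  "endo_matrix vs f =
     mat (length vs) (length vs) (\<lambda>(i, j). representation (set vs) (f (vs ! j)) (vs ! i))"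

definition endo_det :: "('v \<Rightarrow> 'v) \<Rightarrow> 'f" where
  "endo_det f = (THE d. \<exists>vs. ordered_basis vs \<and> d = det (endo_matrix vs f))"

definition isometry :: "('v \<Rightarrow> 'v) \<Rightarrow> bool" where
  "isometry \<sigma> \<longleftrightarrow>
     Vector_Spaces.linear scale scale \<sigma> \<and> bij \<sigma> \<and> (\<forall>x y. b (\<sigma> x) (\<sigma> y) = b x y)"

definition orthogonal_group :: "('v \<Rightarrow> 'v) monoid" where
  "orthogonal_group = \<lparr>carrier = {\<sigma>. isometry \<sigma>}, monoid.mult = (\<circ>), one = id\<rparr>"

definition rotation_group :: "('v \<Rightarrow> 'v) monoid" where
  "rotation_group =
     orthogonal_group\<lparr>carrier := {\<sigma> \<in> carrier orthogonal_group. endo_det \<sigma> = 1}\<rparr>"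

definition reflection :: "'v \<Rightarrow> 'v \<Rightarrow> 'v" where
  "reflection u x = x - scale (2 * (b x u / quadratic_form u)) u"

definition reflection_product :: "'v list \<Rightarrow> 'v \<Rightarrow> 'v" where
  "reflection_product us = foldr (\<circ>) (map reflection us) id"

text \<open>
  In characteristic different from \<open>2\<close>, the definite description is well defined by the
  Cartan--Dieudonne theorem and the independence of the class from the chosen factorization,
  which may have any length.
\<close>

definition spinor_norm :: "('v \<Rightarrow> 'v) \<Rightarrow> 'f set" where
  "spinor_norm \<sigma> =
     (THE c. \<exists>us. (\<forall>u \<in> set us. anisotropic_vector u) \<and> \<sigma> = reflection_product us \<and>
        c = square_class (prod_list (map quadratic_form us)))"

end

end

theory Submission
  imports Defs
begin

text \<open>
  The kernel of the spinor norm on \<open>SO(V)\<close> is a normal subgroup containing all commutators, so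
  projective simplicity forces every rotation to be a central rotation times an element of the
  kernel. The spinor norm is therefore trivial iff it is trivial on the center, which is contained
  in \<open>{id, -id}\<close>. Now \<open>-id\<close> is a rotation iff \<open>n\<close> is even, and being the product of the
  reflections along an orthogonal basis it has the determinant of \<open>b\<close> as its spinor norm.

  That the spinor norm does not depend on the factorization has an elementary proof for
  anisotropic spaces: if \<open>u\<close> lies in the span of \<open>u\<^sub>1, \<dots>, u\<^sub>m\<close>, then the product of the
  reflections along the \<open>u\<^sub>i\<close> can be rewritten with \<open>u\<close> as its first factor, without changing
  the length or the class of the product of the \<open>q(u\<^sub>i)\<close>. In a product equal to the identity,
  the first vector lies in the span of the others, so two factors can be cancelled.
\<close>

section \<open>Projectively simple groups\<close>

context group
begin

lemma inv_commute:
  assumes "a \<otimes> g = g \<otimes> a" "a \<in> carrier G" "g \<in> carrier G"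
  shows "inv a \<otimes> g = g \<otimes> inv a"
proof -
  have "inv a \<otimes> g = inv a \<otimes> (g \<otimes> a) \<otimes> inv a" using assms(2,3) by (simp add: m_assoc)
  also have "\<dots> = inv a \<otimes> (a \<otimes> g) \<otimes> inv a" by (simp only: assms(1))
  also have "\<dots> = (inv a \<otimes> a) \<otimes> (g \<otimes> inv a)"
    using assms(2,3) by (simp only: m_assoc inv_closed m_closed)
  also have "\<dots> = g \<otimes> inv a" using assms(2,3) by simp
  finally show ?thesis .
qed

lemma mult_commute:
  assumes "a \<otimes> g = g \<otimes> a" "c \<otimes> g = g \<otimes> c" "a \<in> carrier G" "c \<in> carrier G" "g \<in> carrier G"
  shows "a \<otimes> c \<otimes> g = g \<otimes> (a \<otimes> c)"
proof -
  have "a \<otimes> c \<otimes> g = a \<otimes> g \<otimes> c" using assms(2-) by (simp add: m_assoc)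
  also have "\<dots> = g \<otimes> (a \<otimes> c)" using assms(3-) by (simp add: assms(1) m_assoc)
  finally show ?thesis .
qed

end

lemma group_center_normal:
  fixes G (structure)
  assumes "group G"
  shows "group_center G \<lhd> G"
proof -
  interpret group G by fact
  have "subgroup (group_center G) G"
  proof (rule subgroupI)
    show "group_center G \<noteq> {}" unfolding group_center_def by auto
  next
    fix a assume a: "a \<in> group_center G"
    then have ac: "a \<in> carrier G" by (simp add: group_center_def)
    have "inv a \<otimes> g = g \<otimes> inv a" if g: "g \<in> carrier G" for g
    proof -
      have "a \<otimes> g = g \<otimes> a" using a g by (simp add: group_center_def)
      then show ?thesis using ac g by (rule inv_commute)
    qed
    then show "inv a \<in> group_center G" using ac by (simp add: group_center_def)
  next
    fix a c assume "a \<in> group_center G" "c \<in> group_center G"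
    then show "a \<otimes> c \<in> group_center G"
      unfolding group_center_def by (blast intro: mult_commute)
  qed (auto simp: group_center_def)
  moreover have "x \<otimes> h \<otimes> inv x = h" if "x \<in> carrier G" "h \<in> group_center G" for x h
  proof -
    have h: "h \<in> carrier G" and "h \<otimes> x = x \<otimes> h" using that by (simp_all add: group_center_def)
    then have "x \<otimes> h \<otimes> inv x = h \<otimes> x \<otimes> inv x" by simp
    then show ?thesis using that(1) h by (simp add: m_assoc)
  qed
  ultimately show ?thesis unfolding normal_inv_iff by simp
qed

text \<open>The image of \<open>N\<close> in the central quotient is normal, so simplicity makes it
  trivial or everything; the two cases pull back to the two alternatives.\<close>

lemma projectively_simple_normal_cases:
  fixes G (structure)
  assumes "projectively_simple G" and N: "N \<lhd> G"
  shows "N \<subseteq> group_center G \<or>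
    (\<forall>g \<in> carrier G. \<exists>z \<in> group_center G. \<exists>k \<in> N. g = z \<otimes> k)"
proof -
  let ?Z = "group_center G" and ?Q = "G Mod group_center G"
  have G: "group G" and simple: "is_simple ?Q"
    using assms(1) by (auto simp: projectively_simple_def)
  interpret group G by fact
  interpret Z: normal ?Z G using group_center_normal[OF G] .
  interpret N: normal N G by fact
  have hom: "group_hom G ?Q (\<lambda>a. ?Z #> a)"
    by (intro group_hom.intro group_hom_axioms.intro G Z.factorgroup_is_group Z.r_coset_hom_Mod)
  have "(\<lambda>a. ?Z #> a) ` N \<lhd> ?Q"
    using hom by (rule N.surj_hom_normal_subgroup) (simp add: carrier_FactGroup)
  with simple have "(\<lambda>a. ?Z #> a) ` N = {?Z} \<or> (\<lambda>a. ?Z #> a) ` N = carrier ?Q"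
    unfolding is_simple_def by simp
  then show ?thesis
  proof
    assume N_triv: "(\<lambda>a. ?Z #> a) ` N = {?Z}"
    have "k \<in> ?Z" if "k \<in> N" for k
    proof -
      have "?Z #> k = ?Z" using N_triv that by blast
      then show ?thesis using rcos_self[OF N.mem_carrier[OF that] Z.subgroup_axioms] by simp
    qed
    then show ?thesis by blast
  next
    assume N_all: "(\<lambda>a. ?Z #> a) ` N = carrier ?Q"
    have "\<exists>z \<in> ?Z. \<exists>k \<in> N. g = z \<otimes> k" if g: "g \<in> carrier G" for g
    proof -
      have "?Z #> g \<in> carrier ?Q" using g by (simp add: carrier_FactGroup)
      then obtain k where k: "k \<in> N" "?Z #> g = ?Z #> k" using N_all by blast
      then have "g \<in> ?Z #> k" using rcos_self[OF g Z.subgroup_axioms] by simp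
      then show ?thesis using k(1) by (auto simp: r_coset_def)
    qed
    then show ?thesis by blast
  qed
qed

text \<open>An abelian group has a one-element central quotient, which \<open>is_simple\<close>
  excludes.\<close>

lemma projectively_simple_not_abelian:
  fixes G (structure)
  assumes "projectively_simple G"
  shows "\<not> carrier G \<subseteq> group_center G"
proof
  assume abelian: "carrier G \<subseteq> group_center G"
  have G: "group G" and simple: "is_simple (G Mod group_center G)"
    using assms by (auto simp: projectively_simple_def)
  interpret group G by fact
  interpret Z: normal "group_center G" G using group_center_normal[OF G] .
  have "group_center G #> a = group_center G" if "a \<in> carrier G" for a
    using that abelian Z.subgroup_axioms coset_join2 by blast
  then have "carrier (G Mod group_center G) = {group_center G}"
    using one_closed unfolding carrier_FactGroup by force
  then show False using simple by (simp add: is_simple_def)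
qed

text \<open>The conjugate of \<open>c\<close> by \<open>x\<close> is the commutator of
  \<open>x\<close> and \<open>c\<close> times \<open>c\<close>, and the commutator, being central,
  also commutes with \<open>g\<close>.\<close>

lemma centralizer_normal:
  fixes G (structure)
  assumes "group G" and g: "g \<in> carrier G"
    and comm: "\<And>x y. x \<in> carrier G \<Longrightarrow> y \<in> carrier G \<Longrightarrow>
      x \<otimes> y \<otimes> inv x \<otimes> inv y \<in> group_center G"
  shows "{c \<in> carrier G. c \<otimes> g = g \<otimes> c} \<lhd> G"
proof -
  interpret group G by fact
  let ?C = "{c \<in> carrier G. c \<otimes> g = g \<otimes> c}"
  have C: "subgroup ?C G"
  proof (rule subgroupI)
    show "?C \<noteq> {}" using g by auto
  next
    fix a assume "a \<in> ?C"
    then have ac: "a \<in> carrier G" and "a \<otimes> g = g \<otimes> a" by auto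
    then show "inv a \<in> ?C" using ac g by (blast intro: inv_commute)
  next
    fix a c assume "a \<in> ?C" "c \<in> ?C"
    then show "a \<otimes> c \<in> ?C" using g by (blast intro: mult_commute)
  qed auto
  moreover have "x \<otimes> c \<otimes> inv x \<in> ?C" if x: "x \<in> carrier G" and c: "c \<in> ?C" for x c
  proof -
    have cc: "c \<in> carrier G" using c by simp
    have "x \<otimes> c \<otimes> inv x \<otimes> inv c \<in> ?C"
      using comm[OF x cc] g by (simp add: group_center_def)
    then have "x \<otimes> c \<otimes> inv x \<otimes> inv c \<otimes> c \<in> ?C"
      using c by (rule subgroup.m_closed[OF C])
    then show ?thesis using x cc by (simp add: m_assoc)
  qed
  ultimately show ?thesis unfolding normal_inv_iff by blast
qed

text \<open>
  If \<open>N\<close> were central, then so would be all commutators, which makes the centralizer of any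
  element normal; applied to a noncentral element this contradicts simplicity.
\<close>

lemma projectively_simple_factorization:
  fixes G (structure)
  assumes ps: "projectively_simple G" and N: "N \<lhd> G"
    and comm: "\<And>x y. x \<in> carrier G \<Longrightarrow> y \<in> carrier G \<Longrightarrow>
      x \<otimes> y \<otimes> inv x \<otimes> inv y \<in> N"
    and g: "g \<in> carrier G"
  shows "\<exists>z \<in> group_center G. \<exists>k \<in> N. g = z \<otimes> k"
proof -
  have G: "group G" using ps by (simp add: projectively_simple_def)
  interpret group G by fact
  have "\<not> N \<subseteq> group_center G"
  proof
    assume NZ: "N \<subseteq> group_center G"
    obtain h where h: "h \<in> carrier G" "h \<notin> group_center G"
      using projectively_simple_not_abelian[OF ps] by blast
    let ?C = "{c \<in> carrier G. c \<otimes> h = h \<otimes> c}"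
    have "?C \<lhd> G" using comm NZ by (intro centralizer_normal G h(1)) blast
    moreover have "\<not> ?C \<subseteq> group_center G" using h by auto
    ultimately have fact: "\<forall>x \<in> carrier G. \<exists>z \<in> group_center G. \<exists>k \<in> ?C. x = z \<otimes> k"
      using projectively_simple_normal_cases[OF ps] by blast
    \<comment> \<open>Both factors of \<open>x\<close> commute with \<open>h\<close>, so
      \<open>h\<close> would be central, against its choice.\<close>
    have "h \<otimes> x = x \<otimes> h" if x: "x \<in> carrier G" for x
    proof -
      obtain z k where zk: "z \<in> group_center G" "k \<in> ?C" "x = z \<otimes> k" using fact x by blast
      have zc: "z \<in> carrier G" and zh: "z \<otimes> h = h \<otimes> z"
        using zk(1) h(1) by (simp_all add: group_center_def)
      have kc: "k \<in> carrier G" and kh: "k \<otimes> h = h \<otimes> k" using zk(2) by simp_all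
      show ?thesis using mult_commute[OF zh kh zc kc h(1)] zk(3) by simp
    qed
    then show False using h by (simp add: group_center_def)
  qed
  then show ?thesis using projectively_simple_normal_cases[OF ps N] g by blast
qed

section \<open>Square classes\<close>

lemma mem_square_class: "x \<in> square_class a \<longleftrightarrow> (\<exists>t. t \<noteq> 0 \<and> x = t\<^sup>2 * a)"
  unfolding square_class_def r_coset_def units_group_def nonzero_squares_def by auto

text \<open>Reduces later claims about cosets to the choice of a nonzero \<open>t\<close> in the
  field.\<close>

lemma square_class_eq_iff:
  "square_class a = square_class c \<longleftrightarrow> (\<exists>t. t \<noteq> 0 \<and> a = t\<^sup>2 * c)" for a c :: "'f::field"
proof
  assume eq: "square_class a = square_class c"
  have "a \<in> square_class a"
    unfolding mem_square_class by (intro exI[of _ "1::'f"]) simp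
  then show "\<exists>t. t \<noteq> 0 \<and> a = t\<^sup>2 * c" by (simp only: eq mem_square_class)
next
  assume "\<exists>t. t \<noteq> 0 \<and> a = t\<^sup>2 * c"
  then obtain t where t: "t \<noteq> 0" "a = t\<^sup>2 * c" by blast
  have "\<exists>r. r \<noteq> 0 \<and> s\<^sup>2 * a = r\<^sup>2 * c" if "s \<noteq> 0" for s
    using t that by (intro exI[of _ "s * t"]) (simp add: power_mult_distrib)
  moreover have "\<exists>r. r \<noteq> 0 \<and> s\<^sup>2 * c = r\<^sup>2 * a" if "s \<noteq> 0" for s
    using t that by (intro exI[of _ "s / t"]) (simp add: power_divide)
  ultimately show "square_class a = square_class c"
    unfolding set_eq_iff mem_square_class by blast
qed

lemma square_class_eq_one_iff:
  "square_class a = \<one>\<^bsub>square_class_group\<^esub> \<longleftrightarrow> (\<exists>t. t \<noteq> 0 \<and> a = t\<^sup>2)" for a :: "'f::field"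
proof -
  have "\<one>\<^bsub>square_class_group\<^esub> = square_class (1::'f)"
    unfolding square_class_group_def one_FactGroup
    by (auto simp: square_class_def r_coset_def units_group_def)
  then show ?thesis by (simp add: square_class_eq_iff)
qed

section \<open>Determinants\<close>

context bilinear_space
begin

text \<open>Separate source and target bases make a base change the matrix of \<open>id\<close>, so
  that one product rule covers composition and change of basis.\<close>

definition rep_matrix :: "'v list \<Rightarrow> 'v list \<Rightarrow> ('v \<Rightarrow> 'v) \<Rightarrow> 'f mat" where
  "rep_matrix ws vs f =
     mat (length ws) (length vs) (\<lambda>(i, j). representation (set ws) (f (vs ! j)) (ws ! i))"

lemma endo_matrix_eq_rep_matrix: "endo_matrix vs f = rep_matrix vs vs f"
  by (simp add: endo_matrix_def rep_matrix_def)

lemma length_ordered_basis: "ordered_basis vs \<Longrightarrow> length vs = dim UNIV"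
  using dim_eq_card[of "set vs" UNIV] by (simp add: ordered_basis_def distinct_card)

lemma rep_matrix_carrier:
  "ordered_basis vs \<Longrightarrow> ordered_basis ws \<Longrightarrow> rep_matrix ws vs f \<in> carrier_mat (dim UNIV) (dim UNIV)"
  by (simp add: rep_matrix_def length_ordered_basis)

lemma ordered_basis_expansion:
  assumes "ordered_basis vs"
  shows "(\<Sum>k<length vs. scale (representation (set vs) x (vs ! k)) (vs ! k)) = x"
proof -
  have "bij_betw ((!) vs) {..<length vs} (set vs)"
    using assms by (intro bij_betw_nth) (simp_all add: ordered_basis_def)
  then have "(\<Sum>k<length vs. scale (representation (set vs) x (vs ! k)) (vs ! k))
    = (\<Sum>v\<in>set vs. scale (representation (set vs) x v) v)"
    by (rule sum.reindex_bij_betw)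
  also have "\<dots> = x"
    using assms by (intro sum_representation_eq) (auto simp: ordered_basis_def)
  finally show ?thesis .
qed

lemma representation_image_expansion:
  assumes f: "Vector_Spaces.linear scale scale f" and "ordered_basis us" "ordered_basis vs"
  shows "representation (set us) (f x) u =
    (\<Sum>k<length vs. representation (set us) (f (vs ! k)) u * representation (set vs) x (vs ! k))"
proof -
  interpret f: Vector_Spaces.linear scale scale f by (fact f)
  have us: "independent (set us)" "span (set us) = UNIV"
    using assms(2) by (simp_all add: ordered_basis_def)
  have "f x = f (\<Sum>k<length vs. scale (representation (set vs) x (vs ! k)) (vs ! k))"
    by (simp add: ordered_basis_expansion[OF assms(3)])
  also have "\<dots> = (\<Sum>k<length vs. scale (representation (set vs) x (vs ! k)) (f (vs ! k)))"
    by (simp add: f.sum f.scale)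
  finally show ?thesis
    using us by (simp add: representation_sum representation_scale mult.commute)
qed

lemma rep_matrix_mult:
  assumes "Vector_Spaces.linear scale scale g" "ordered_basis us" "ordered_basis vs"
  shows "rep_matrix us vs g * rep_matrix vs ws f = rep_matrix us ws (g \<circ> f)"
proof (rule eq_matI)
  fix i j assume "i < dim_row (rep_matrix us ws (g \<circ> f))" "j < dim_col (rep_matrix us ws (g \<circ> f))"
  then show "(rep_matrix us vs g * rep_matrix vs ws f) $$ (i, j) = rep_matrix us ws (g \<circ> f) $$ (i, j)"
    by (simp add: rep_matrix_def scalar_prod_def atLeast0LessThan
        flip: representation_image_expansion[OF assms])
qed (simp_all add: rep_matrix_def)

lemma rep_matrix_id:
  assumes "ordered_basis vs"
  shows "rep_matrix vs vs id = 1\<^sub>m (dim UNIV)"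
  using assms length_ordered_basis[OF assms]
  by (intro eq_matI)
    (auto simp: rep_matrix_def ordered_basis_def representation_basis nth_eq_iff_index_eq)

text \<open>The two base change matrices are mutually inverse; in particular neither determinant
  vanishes.\<close>

lemma det_base_change:
  assumes "ordered_basis vs" "ordered_basis ws"
  shows "det (rep_matrix ws vs id) * det (rep_matrix vs ws id) = 1"
proof -
  have "det (rep_matrix ws vs id) * det (rep_matrix vs ws id)
    = det (rep_matrix ws vs id * rep_matrix vs ws id)"
    using assms by (intro det_mult[symmetric, of _ "dim UNIV"] rep_matrix_carrier)
  also have "\<dots> = 1"
    using assms by (simp add: rep_matrix_mult linear_id rep_matrix_id)
  finally show ?thesis .
qed

text \<open>The matrices of \<open>f\<close> in two bases are similar, so the base change
  determinants cancel and the definite description has a unique solution.\<close>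

lemma endo_det_eq:
  assumes f: "Vector_Spaces.linear scale scale f" and vs: "ordered_basis vs"
  shows "endo_det f = det (rep_matrix vs vs f)"
  unfolding endo_det_def endo_matrix_eq_rep_matrix
proof (rule the_equality)
  show "\<exists>ws. ordered_basis ws \<and> det (rep_matrix vs vs f) = det (rep_matrix ws ws f)"
    using vs by blast
next
  fix d assume "\<exists>ws. ordered_basis ws \<and> d = det (rep_matrix ws ws f)"
  then obtain ws where ws: "ordered_basis ws" and d: "d = det (rep_matrix ws ws f)" by blast
  have "rep_matrix ws ws f = rep_matrix ws vs id * (rep_matrix vs vs f * rep_matrix vs ws id)"
    using f vs ws by (simp add: rep_matrix_mult linear_id)
  then have "d = det (rep_matrix ws vs id * (rep_matrix vs vs f * rep_matrix vs ws id))"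
    using d by simp
  also have "\<dots> = det (rep_matrix ws vs id) * (det (rep_matrix vs vs f) * det (rep_matrix vs ws id))"
    by (simp add: det_mult[OF rep_matrix_carrier[OF vs ws] mult_carrier_mat[OF
      rep_matrix_carrier[OF vs vs] rep_matrix_carrier[OF ws vs]]]
      det_mult[OF rep_matrix_carrier[OF vs vs] rep_matrix_carrier[OF ws vs]])
  also have "\<dots> = (det (rep_matrix ws vs id) * det (rep_matrix vs ws id)) * det (rep_matrix vs vs f)"
    by (simp only: mult_ac)
  finally show "d = det (rep_matrix vs vs f)"
    using det_base_change[OF vs ws] by simp
qed

text \<open>A maximal independent set spans and is finite here. The empty set yields some basis; a
  singleton later yields a basis adapted to a reflection.\<close>

lemma ordered_basis_extend:
  assumes "independent S"
  obtains vs where "ordered_basis vs" "S \<subseteq> set vs"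
proof -
  obtain B where B: "finite B" "span B = UNIV" using finite_dimensional by blast
  obtain C where C: "S \<subseteq> C" "independent C" "span C = UNIV"
    using maximal_independent_subset_extend[OF subset_UNIV assms] by (metis top.extremum_unique)
  then have "finite C" using independent_span_bound[OF B(1) C(2)] B(2) by simp
  then obtain vs where "set vs = C" "distinct vs" using finite_distinct_list by blast
  then show thesis using that[of vs] C by (simp add: ordered_basis_def)
qed

lemma endo_det_comp:
  assumes "Vector_Spaces.linear scale scale f" "Vector_Spaces.linear scale scale g"
  shows "endo_det (f \<circ> g) = endo_det f * endo_det g"
proof -
  obtain vs where vs: "ordered_basis vs" using ordered_basis_extend[OF independent_empty] .
  have "endo_det (f \<circ> g) = det (rep_matrix vs vs f * rep_matrix vs vs g)"
    using assms vs endo_det_eq[OF Vector_Spaces.linear_compose[OF assms(2,1)] vs]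
    by (simp add: rep_matrix_mult)
  then show ?thesis
    using assms vs det_mult[OF rep_matrix_carrier rep_matrix_carrier] by (simp add: endo_det_eq)
qed

lemma endo_det_uminus: "endo_det uminus = (- 1) ^ dim UNIV"
proof -
  obtain vs where vs: "ordered_basis vs" using ordered_basis_extend[OF independent_empty] .
  have "rep_matrix vs vs uminus = - 1 \<cdot>\<^sub>m rep_matrix vs vs id"
    using vs by (intro eq_matI) (auto simp: rep_matrix_def ordered_basis_def representation_neg)
  then show ?thesis
    using endo_det_eq[OF linear_uminus vs] rep_matrix_id[OF vs] by simp
qed

section \<open>Gram matrices and the determinant of the form\<close>

lemma form_sum_left: "b (sum f A) z = (\<Sum>i\<in>A. b (f i) z)"
proof -
  have "b 0 z = 0" using form_scale_left[of 0 0 z] by simp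
  then show ?thesis by (induction A rule: infinite_finite_induct) (simp_all add: form_add_left)
qed

text \<open>Both arguments of \<open>b (ws ! i) (ws ! j)\<close> are expanded in \<open>vs\<close>:
  \<open>left\<close> treats the first one, and \<open>right\<close> follows from it by
  symmetry.\<close>

lemma gram_matrix_base_change:
  assumes "ordered_basis vs"
  shows "gram_matrix ws = (rep_matrix vs ws id)\<^sup>T * (gram_matrix vs * rep_matrix vs ws id)"
proof (rule eq_matI)
  let ?P = "rep_matrix vs ws id"
  let ?c = "\<lambda>i k. representation (set vs) (ws ! i) (vs ! k)"
  fix i j assume "i < dim_row (?P\<^sup>T * (gram_matrix vs * ?P))" "j < dim_col (?P\<^sup>T * (gram_matrix vs * ?P))"
  then have ij: "i < length ws" "j < length ws" by (simp_all add: rep_matrix_def)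
  have left: "b x y = (\<Sum>k<length vs. representation (set vs) x (vs ! k) * b (vs ! k) y)" for x y
    using form_sum_left[of "\<lambda>k. scale (representation (set vs) x (vs ! k)) (vs ! k)" "{..<length vs}" y]
    by (simp add: ordered_basis_expansion[OF assms] form_scale_left)
  have right: "b x y = (\<Sum>k<length vs. b x (vs ! k) * representation (set vs) y (vs ! k))" for x y
    using left[of y x] by (simp only: form_sym[of x] mult.commute)
  have "b (ws ! i) (ws ! j)
    = (\<Sum>k<length vs. ?c i k * (\<Sum>l<length vs. b (vs ! k) (vs ! l) * ?c j l))"
    unfolding left[of "ws ! i" "ws ! j"] right[of "vs ! k" "ws ! j" for k] ..
  then show "gram_matrix ws $$ (i, j) = (?P\<^sup>T * (gram_matrix vs * ?P)) $$ (i, j)"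
    using ij by (simp add: gram_matrix_def rep_matrix_def scalar_prod_def atLeast0LessThan)
qed (simp_all add: gram_matrix_def rep_matrix_def)

text \<open>Congruence by the base change matrix multiplies the Gram determinant by the square of a
  nonzero determinant.\<close>

lemma form_det_eq:
  assumes vs: "ordered_basis vs"
  shows "form_det = square_class (det (gram_matrix vs))"
  unfolding form_det_def
proof (rule the_equality)
  show "\<exists>ws. ordered_basis ws \<and> square_class (det (gram_matrix vs)) = square_class (det (gram_matrix ws))"
    using vs by blast
next
  fix c assume "\<exists>ws. ordered_basis ws \<and> c = square_class (det (gram_matrix ws))"
  then obtain ws where ws: "ordered_basis ws" and c: "c = square_class (det (gram_matrix ws))" by blast
  let ?P = "rep_matrix vs ws id"
  have P: "?P \<in> carrier_mat (dim UNIV) (dim UNIV)" using vs ws by (intro rep_matrix_carrier)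
  have G: "gram_matrix vs \<in> carrier_mat (dim UNIV) (dim UNIV)"
    using length_ordered_basis[OF vs] by (simp add: gram_matrix_def)
  have "det (gram_matrix ws) = det (?P\<^sup>T) * (det (gram_matrix vs) * det ?P)"
    unfolding gram_matrix_base_change[OF vs, of ws]
    using P G by (simp add: det_mult[of _ "dim UNIV"])
  then have "det (gram_matrix ws) = (det ?P)\<^sup>2 * det (gram_matrix vs)"
    using det_transpose[OF P] by (simp add: power2_eq_square)
  moreover have "det ?P \<noteq> 0" using det_base_change[OF vs ws] by auto
  ultimately show "c = square_class (det (gram_matrix vs))"
    unfolding c square_class_eq_iff by blast
qed

lemma det_gram_matrix_orthogonal:
  assumes "distinct es" "\<And>x y. x \<in> set es \<Longrightarrow> y \<in> set es \<Longrightarrow> x \<noteq> y \<Longrightarrow> b x y = 0"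
  shows "det (gram_matrix es) = prod_list (map quadratic_form es)"
proof -
  have G: "gram_matrix es \<in> carrier_mat (length es) (length es)"
    by (simp add: gram_matrix_def)
  have "upper_triangular (gram_matrix es)"
    using assms by (auto simp: gram_matrix_def nth_eq_iff_index_eq intro!: upper_triangularI)
  moreover have "diag_mat (gram_matrix es) = map quadratic_form es"
    by (auto simp: diag_mat_def gram_matrix_def quadratic_form_def intro: nth_equalityI)
  ultimately show ?thesis using det_upper_triangular[OF _ G] by simp
qed

end

section \<open>Reflections and spinor norms of anisotropic spaces\<close>

locale anisotropic_space = bilinear_space scale b
  for scale :: "'f::field \<Rightarrow> 'v::ab_group_add \<Rightarrow> 'v" (infixr \<open>*s\<close> 75)
    and b :: "'v \<Rightarrow> 'v \<Rightarrow> 'f" +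
  assumes two_nonzero: "(2::'f) \<noteq> 0"
    and anisotropic
begin

abbreviation q :: "'v \<Rightarrow> 'f" where "q \<equiv> quadratic_form"

text \<open>Anisotropy as a rewrite rule: a vector may be reflected along as soon as it is
  nonzero.\<close>

lemma q_eq_0_iff [simp]: "q u = 0 \<longleftrightarrow> u = 0"
proof -
  have "b 0 0 = 0" using form_scale_left[of 0 0 0] by simp
  then show ?thesis
    using anisotropic_space_axioms[unfolded anisotropic_space_def anisotropic_space_axioms_def]
    by (auto simp: anisotropic_def anisotropic_vector_def quadratic_form_def)
qed

lemma q_zero [simp]: "q 0 = 0"
  by simp

lemma anisotropic_vector_iff [simp]: "anisotropic_vector u \<longleftrightarrow> u \<noteq> 0"
  by (simp add: anisotropic_vector_def)

lemma b_self [simp]: "b u u = q u"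
  by (simp add: quadratic_form_def)

lemma linear_endo_iff:
  "Vector_Spaces.linear (*s) (*s) f \<longleftrightarrow>
    (\<forall>x y. f (x + y) = f x + f y) \<and> (\<forall>c x. f (c *s x) = c *s f x)"
  using Vector_Spaces.linear_iff[of "(*s)" "(*s)" f] vector_space_axioms by blast

lemma form_diff_left: "b (x - y) z = b x z - b y z"
  using form_add_left[of "x - y" y z] by (simp add: algebra_simps)

lemma form_minus_left: "b (- x) z = - b x z"
  using form_scale_left[of "-1" x z] by simp

lemma form_zero_left [simp]: "b 0 z = 0"
  using form_scale_left[of 0 0 z] by simp

lemma form_add_right: "b z (x + y) = b z x + b z y"
  by (simp add: form_sym[of z] form_add_left)

lemma form_scale_right: "b x (c *s y) = c * b x y"
  by (simp add: form_sym[of x] form_scale_left)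

lemma form_diff_right: "b z (x - y) = b z x - b z y"
  by (simp add: form_sym[of z] form_diff_left)

lemma form_minus_right: "b z (- x) = - b z x"
  by (simp add: form_sym[of z] form_minus_left)

lemma form_zero_right [simp]: "b z 0 = 0"
  by (simp add: form_sym[of z])

lemmas form_simps = form_add_left form_add_right form_diff_left form_diff_right
  form_minus_left form_minus_right form_scale_left form_scale_right

lemma q_scale: "q (c *s u) = c\<^sup>2 * q u"
  by (simp add: quadratic_form_def form_simps power2_eq_square del: b_self)

lemma double: "(2::'f) *s x = x + x"
  using scale_left_distrib[of 1 1 x] by simp

lemma reflection_self: "reflection u u = - u"
proof (cases "u = 0")
  case False
  have "reflection u u = u - 2 *s u"
    using False by (simp add: reflection_def)
  then show ?thesis by (simp add: double)
qed (simp add: reflection_def)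

lemma reflection_orthogonal: "b x u = 0 \<Longrightarrow> reflection u x = x"
  by (simp add: reflection_def)

lemma reflection_add: "reflection u (x + y) = reflection u x + reflection u y"
  by (simp add: reflection_def form_add_left add_divide_distrib distrib_left scale_left_distrib)

lemma reflection_scale: "reflection u (c *s x) = c *s reflection u x"
  by (simp add: reflection_def form_scale_left scale_right_diff_distrib mult_ac)

lemma reflection_scaled: "c \<noteq> 0 \<Longrightarrow> reflection (c *s u) = reflection u"
  by (rule ext) (simp add: reflection_def form_scale_right q_scale power2_eq_square)

lemma form_reflection:
  assumes "u \<noteq> 0"
  shows "b (reflection u x) (reflection u y) = b x y"
  using assms by (simp add: reflection_def form_simps form_sym[of u y])

lemma reflection_involutive [simp]:
  assumes "u \<noteq> 0"
  shows "reflection u (reflection u x) = x"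
proof -
  have "reflection u (x + (- (2 * (b x u / q u))) *s u)
    = reflection u x + (2 * (b x u / q u)) *s u"
    by (simp only: reflection_add reflection_scale reflection_self) simp
  then show ?thesis by (simp add: reflection_def)
qed

lemma linear_reflection: "Vector_Spaces.linear (*s) (*s) (reflection u)"
  unfolding linear_endo_iff by (simp add: reflection_add reflection_scale)

lemma isometry_reflection:
  assumes "u \<noteq> 0"
  shows "isometry (reflection u)"
  unfolding isometry_def
proof (intro conjI allI)
  show "Vector_Spaces.linear (*s) (*s) (reflection u)" by (rule linear_reflection)
  show "bij (reflection u)"
    using assms by (intro o_bij[of "reflection u"]) (simp_all add: fun_eq_iff)
qed (simp add: form_reflection assms)

lemma isometry_id: "isometry id"
  by (simp add: isometry_def linear_id)

lemma isometry_comp: "isometry \<sigma> \<Longrightarrow> isometry \<tau> \<Longrightarrow> isometry (\<sigma> \<circ> \<tau>)"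
  unfolding isometry_def linear_endo_iff by (auto intro: bij_comp)

section \<open>Products of reflections\<close>

lemma reflection_product_Nil [simp]: "reflection_product [] = id"
  and reflection_product_Cons: "reflection_product (u # us) = reflection u \<circ> reflection_product us"
  by (simp_all add: reflection_product_def)

lemma reflection_product_append:
  "reflection_product (us @ vs) = reflection_product us \<circ> reflection_product vs"
  by (induction us) (simp_all add: reflection_product_Cons comp_assoc)

text \<open>Reflections are involutions, so the reversed list gives the inverse.\<close>

lemma reflection_product_rev:
  "0 \<notin> set us \<Longrightarrow> reflection_product (rev us) \<circ> reflection_product us = id"
proof (induction us)
  case (Cons u us)
  then have "reflection_product (rev us) (reflection_product us x) = x" for x
    by (simp add: fun_eq_iff)
  then show ?case
    using Cons.prems by (simp add: reflection_product_Cons reflection_product_append fun_eq_iff)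
qed simp

lemma isometry_reflection_product: "0 \<notin> set us \<Longrightarrow> isometry (reflection_product us)"
  by (induction us)
    (auto simp: reflection_product_Cons isometry_id intro!: isometry_comp isometry_reflection)

section \<open>Independence of the spinor norm from the factorization\<close>

text \<open>Each factor changes its argument only by a multiple of its own vector.\<close>

lemma reflection_product_diff_mem_span: "reflection_product us x - x \<in> span (set us)"
proof (induction us)
  case (Cons u us)
  let ?y = "reflection_product us x"
  have "?y - x \<in> span (set (u # us))"
    using Cons span_mono[of "set us" "set (u # us)"] by auto
  moreover have "(2 * (b ?y u / q u)) *s u \<in> span (set (u # us))"
    by (intro span_scale span_base) simp
  ultimately have "(?y - x) - (2 * (b ?y u / q u)) *s u \<in> span (set (u # us))"
    by (rule span_diff)
  then show ?case by (simp add: reflection_product_Cons reflection_def algebra_simps)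
qed (simp add: span_zero)

lemma mem_span_doubleD: "x + x \<in> span S \<Longrightarrow> x \<in> span S"
  using span_scale[of "2 *s x" S "inverse 2"] two_nonzero by (simp flip: double)

text \<open>The factors after the first must send \<open>u\<close> to \<open>- u\<close>. They
  displace \<open>u\<close> by \<open>- (u + u)\<close>, and displacements stay in the span of their
  vectors.\<close>

lemma reflection_product_eq_id_imp_mem_span:
  assumes "u \<noteq> 0" and "reflection_product (u # us) = id"
  shows "u \<in> span (set us)"
proof -
  have "reflection u (reflection_product us u) = u"
    using assms(2) by (simp add: reflection_product_Cons fun_eq_iff)
  then have "reflection_product us u = reflection u u"
    using assms(1) by (metis reflection_involutive)
  then have "- (u + u) \<in> span (set us)"
    using reflection_product_diff_mem_span[of us u] by (simp add: reflection_self)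
  then have "u + u \<in> span (set us)" using span_neg by fastforce
  then show ?thesis by (rule mem_span_doubleD)
qed

text \<open>In the Clifford algebra, the vector \<open>v'\<close> is the product \<open>w u v\<close>, \<open>w = c u + v\<close>.\<close>

lemma reflection_pair_rotate:
  assumes "u \<noteq> 0" "v \<noteq> 0" "c *s u + v \<noteq> 0"
  obtains v' where "v' \<noteq> 0"
    "reflection u \<circ> reflection v = reflection (c *s u + v) \<circ> reflection v'"
    "q v' = q (c *s u + v) * q u * q v"
proof -
  define w where "w = c *s u + v"
  \<comment> \<open>With \<open>u v + v u = 2 b u v\<close> in the Clifford algebra,
    \<open>v u v\<close> is \<open>2 b u v\<close> times \<open>v\<close> minus \<open>q v\<close>
    times \<open>u\<close>; expanding \<open>w u v\<close> gives this combination.\<close>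
  define v' where "v' = (c * q u + 2 * b u v) *s v - q v *s u"
  have qw: "q w = c\<^sup>2 * q u + 2 * c * b u v + q v"
    unfolding quadratic_form_def w_def
    by (simp add: form_simps form_sym[of v u] power2_eq_square algebra_simps del: b_self)
  have qv': "q v' = q w * q u * q v"
    unfolding qw unfolding quadratic_form_def v'_def
    by (simp add: form_simps form_sym[of v u] power2_eq_square algebra_simps del: b_self)
  have nz: "q u \<noteq> 0" "q v \<noteq> 0" "q w \<noteq> 0" using assms by (simp_all add: w_def)
  then have "v' \<noteq> 0" using qv' by auto
  moreover have "reflection u (reflection v x) = reflection w (reflection v' x)" for x
  proof -
    \<comment> \<open>Both sides subtract from \<open>x\<close> a combination of \<open>u\<close>
      and \<open>v\<close>. Naming the form values as scalars leaves two field identities, one per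
      coefficient.\<close>
    define s t p A B Q where defs: "s = b x u" "t = b x v" "p = b u v" "A = q u" "B = q v"
      "Q = q w"
    have nz': "A \<noteq> 0" "B \<noteq> 0" "Q \<noteq> 0" and Q: "Q = c\<^sup>2 * A + 2 * c * p + B"
      using nz qw by (simp_all add: defs)
    define m k where "m = 2 * (b x v' / q v')" and "k = 2 * (b (x - m *s v') w / Q)"
    have m: "m = 2 * ((c * A + 2 * p) * t - B * s) / (Q * A * B)"
      unfolding m_def qv' unfolding v'_def by (simp add: form_simps defs)
    \<comment> \<open>The factor \<open>Q\<close> cancels the denominator of
      \<open>k\<close>.\<close>
    have "b v' w = p * Q"
      unfolding v'_def w_def Q
      by (simp add: form_simps form_sym[of v u] defs power2_eq_square algebra_simps)
    moreover have "b x w = c * s + t"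
      by (simp add: w_def form_simps defs)
    moreover have "k = 2 * (b x w - m * b v' w) / Q"
      by (simp add: k_def form_diff_left form_scale_left)
    ultimately have k: "k = 2 * (c * s + t) / Q - 2 * m * p"
      using nz' by (simp add: field_simps)
    have "reflection u (reflection v x) = x - (2 * t / B) *s v - (2 * (s - 2 * t * p / B) / A) *s u"
      by (simp add: reflection_def form_simps form_sym[of v u] defs)
    moreover have "reflection w (reflection v' x) = x - m *s v' - k *s w"
      by (simp add: reflection_def m_def k_def defs)
    moreover have "\<dots> = x - (m * (c * A + 2 * p) + k) *s v - (k * c - m * B) *s u"
      by (simp add: v'_def w_def defs algebra_simps)
    moreover have "m * (c * A + 2 * p) + k = 2 * t / B"
    proof -
      have "m * (c * A + 2 * p) + k = 2 * (c * ((c * A + 2 * p) * t - B * s) + B * (c * s + t)) / (Q * B)"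
        unfolding k m using nz' by (simp add: divide_simps) (simp add: algebra_simps)
      also have "\<dots> = 2 * t * Q / (Q * B)"
        unfolding Q by (simp add: power2_eq_square algebra_simps)
      finally show ?thesis using nz' by simp
    qed
    moreover have "k * c - m * B = 2 * (s - 2 * t * p / B) / A"
    proof -
      have "k * c - m * B = 2 * (c * (c * s + t) * A * B
          - ((c * A + 2 * p) * t - B * s) * (2 * c * p + B)) / (Q * A * B)"
        unfolding k m using nz' by (simp add: divide_simps) (simp add: algebra_simps)
      also have "\<dots> = 2 * (s * B - 2 * t * p) * Q / (Q * A * B)"
        unfolding Q by (simp add: power2_eq_square algebra_simps)
      also have "\<dots> = 2 * (s - 2 * t * p / B) / A"
        using nz' by (simp add: divide_simps)
      finally show ?thesis .
    qed
    ultimately show ?thesis by simp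
  qed
  ultimately show thesis using that qv' by (auto simp: w_def fun_eq_iff)
qed

text \<open>Write \<open>u\<close> as \<open>c\<close> times \<open>a\<close> plus a vector
  \<open>w\<close> in the span of the tail. If \<open>w\<close> vanishes, then \<open>u\<close> and
  \<open>a\<close> give the same reflection. Otherwise induction brings \<open>w\<close> to the
  front of the tail, and \<open>reflection_pair_rotate\<close> replaces the pair \<open>a\<close>,
  \<open>w\<close> by a pair starting with \<open>u\<close>.\<close>

lemma reflection_product_pull_to_front:
  assumes "u \<in> span (set us)" "u \<noteq> 0" "0 \<notin> set us"
  shows "\<exists>vs t. 0 \<notin> set vs \<and> Suc (length vs) = length us \<and>
    reflection_product (u # vs) = reflection_product us \<and>
    t \<noteq> 0 \<and> prod_list (map q us) = t\<^sup>2 * prod_list (map q (u # vs))"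
  using assms
proof (induction us arbitrary: u)
  case (Cons a us)
  have a: "a \<noteq> 0" "0 \<notin> set us" using Cons.prems(3) by auto
  obtain c where c: "u - c *s a \<in> span (set us)"
    using Cons.prems(1) by (auto simp: span_breakdown_eq)
  show ?case
  proof (cases "u = c *s a")
    case True
    then have "c \<noteq> 0" using Cons.prems(2) by auto
    then show ?thesis using True a
      \<comment> \<open>Here \<open>q u\<close> is \<open>c\<close> squared times
        \<open>q a\<close>, which is undone by the square of \<open>inverse c\<close>.\<close>
      by (intro exI[of _ us] exI[of _ "inverse c"])
        (simp add: reflection_product_Cons reflection_scaled q_scale power_inverse)
  next
    case False
    define w where "w = u - c *s a"
    have w: "w \<noteq> 0" "c *s a + w = u" using False by (simp_all add: w_def)
    obtain vs t where vs: "0 \<notin> set vs" "Suc (length vs) = length us"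
      "reflection_product (w # vs) = reflection_product us" and t: "t \<noteq> 0"
      "prod_list (map q us) = t\<^sup>2 * prod_list (map q (w # vs))"
      using Cons.IH[of w] c w(1) a(2) unfolding w_def by blast
    obtain v where v: "v \<noteq> 0" "reflection a \<circ> reflection w = reflection u \<circ> reflection v"
      "q v = q u * q a * q w"
      using reflection_pair_rotate[OF a(1) w(1), of c] w(2) Cons.prems(2) by auto
    have "reflection_product (a # us) = (reflection a \<circ> reflection w) \<circ> reflection_product vs"
      using vs(3) by (simp add: reflection_product_Cons comp_assoc)
    also have "\<dots> = reflection_product (u # v # vs)"
      unfolding v(2) by (simp add: reflection_product_Cons comp_assoc)
    finally have "reflection_product (u # v # vs) = reflection_product (a # us)" by simp
    \<comment> \<open>As \<open>q v = q u * q a * q w\<close>, the new pair contributes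
      \<open>q u\<close> squared times \<open>q a * q w\<close>; hence the divisor
      \<open>q u\<close>.\<close>
    moreover have "prod_list (map q (a # us)) = (t / q u)\<^sup>2 * prod_list (map q (u # v # vs))"
      using t(2) Cons.prems(2) by (simp add: v(3) power2_eq_square field_simps)
    ultimately show ?thesis using vs(1,2) v(1) t(1) Cons.prems(2)
      by (intro exI[of _ "v # vs"] exI[of _ "t / q u"]) auto
  qed
qed simp

text \<open>
  If the product is the identity, then the first vector lies in the span of the others and can be
  pulled to their front, where it cancels.
\<close>

lemma reflection_product_eq_id_imp_square:
  assumes "0 \<notin> set us" "reflection_product us = id"
  shows "\<exists>t. t \<noteq> 0 \<and> prod_list (map q us) = t\<^sup>2"
  using assms
proof (induction us rule: length_induct)
  case (1 us)
  show ?case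
  proof (cases us)
    case Nil
    then show ?thesis by (intro exI[of _ 1]) simp
  next
    case (Cons u us')
    have u: "u \<noteq> 0" "0 \<notin> set us'" using 1 Cons by auto
    have "u \<in> span (set us')"
      using 1(3) unfolding Cons by (rule reflection_product_eq_id_imp_mem_span[OF u(1)])
    then obtain vs t where vs: "0 \<notin> set vs" "Suc (length vs) = length us'"
      "reflection_product (u # vs) = reflection_product us'"
      and t: "t \<noteq> 0" "prod_list (map q us') = t\<^sup>2 * prod_list (map q (u # vs))"
      using reflection_product_pull_to_front u by blast
    have "reflection_product us = reflection u \<circ> reflection_product (u # vs)"
      using vs(3) Cons by (simp add: reflection_product_Cons)
    then have "reflection_product vs = id"
      using 1 u(1) by (simp add: reflection_product_Cons fun_eq_iff)
    moreover have "length vs < length us" using vs(2) Cons by simp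
    ultimately obtain r where r: "r \<noteq> 0" "prod_list (map q vs) = r\<^sup>2"
      using 1 vs(1) by blast
    \<comment> \<open>The cancelled vector \<open>u\<close> occurs twice, so it contributes only the
      square of \<open>q u\<close>.\<close>
    have "prod_list (map q us) = (q u * t * r)\<^sup>2"
      using Cons t(2) r(2) by (simp add: power2_eq_square)
    then show ?thesis using u(1) t(1) r(1) by (intro exI[of _ "q u * t * r"]) simp
  qed
qed

lemma prod_list_q_nonzero: "0 \<notin> set us \<Longrightarrow> prod_list (map q us) \<noteq> 0"
  by (induction us) auto

text \<open>For two factorizations of one isometry, reversing one and appending the other gives the
  identity. The product of their two values is thus a square, so the classes agree.\<close>

lemma spinor_norm_reflection_product:
  assumes "0 \<notin> set us"
  shows "spinor_norm (reflection_product us) = square_class (prod_list (map q us))"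
  unfolding spinor_norm_def
proof (rule the_equality)
  show "\<exists>vs. (\<forall>u\<in>set vs. anisotropic_vector u) \<and> reflection_product us = reflection_product vs \<and>
      square_class (prod_list (map q us)) = square_class (prod_list (map q vs))"
    using assms by (intro exI[of _ us]) auto
next
  fix c assume "\<exists>vs. (\<forall>u\<in>set vs. anisotropic_vector u) \<and>
    reflection_product us = reflection_product vs \<and> c = square_class (prod_list (map q vs))"
  then obtain vs where vs: "0 \<notin> set vs" "reflection_product us = reflection_product vs"
    and c: "c = square_class (prod_list (map q vs))" by auto
  have "reflection_product (rev us @ vs) = id"
    using reflection_product_rev[OF assms] vs(2) by (simp add: reflection_product_append)
  then obtain t where t: "t \<noteq> 0" "prod_list (map q (rev us @ vs)) = t\<^sup>2"
    using reflection_product_eq_id_imp_square[of "rev us @ vs"] assms vs(1) by auto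
  let ?P = "prod_list (map q us)"
  have P: "?P \<noteq> 0" using prod_list_q_nonzero[OF assms] .
  have "prod_list (map q vs) = (t / ?P)\<^sup>2 * ?P"
    using t(2) P prod_list.rev[of "map q us"]
    by (simp add: rev_map power2_eq_square field_simps)
  then show "c = square_class ?P"
    unfolding c square_class_eq_iff using t(1) P by (intro exI[of _ "t / ?P"]) simp
qed

section \<open>The Cartan-Dieudonne theorem and multiplicativity of the spinor norm\<close>

lemma isometry_linear:
  assumes "isometry \<sigma>"
  shows "\<sigma> (x + y) = \<sigma> x + \<sigma> y" "\<sigma> (c *s x) = c *s \<sigma> x" "\<sigma> (x - y) = \<sigma> x - \<sigma> y"
proof -
  show add: "\<sigma> (x + y) = \<sigma> x + \<sigma> y" for x y
    using assms by (simp add: isometry_def linear_endo_iff)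
  show "\<sigma> (c *s x) = c *s \<sigma> x"
    using assms by (simp add: isometry_def linear_endo_iff)
  show "\<sigma> (x - y) = \<sigma> x - \<sigma> y"
    using add[of "x - y" y] by (simp add: algebra_simps)
qed

lemma form_isometry: "isometry \<sigma> \<Longrightarrow> b (\<sigma> x) (\<sigma> y) = b x y"
  by (simp add: isometry_def)

lemma q_isometry: "isometry \<sigma> \<Longrightarrow> q (\<sigma> x) = q x"
  by (simp add: isometry_def quadratic_form_def del: b_self)

text \<open>Equal values of \<open>q\<close> give \<open>q (y - x) = 2 * b y (y - x)\<close>, so
  reflecting \<open>y\<close> subtracts exactly \<open>y - x\<close>.\<close>

lemma reflection_diff_isometric:
  assumes "q y = q x" "x \<noteq> y"
  shows "reflection (y - x) y = x"
proof -
  have "q (y - x) = 2 * b y (y - x)"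
    using assms(1) unfolding quadratic_form_def
    by (simp add: form_simps form_sym[of x y] del: b_self)
  moreover have "q (y - x) \<noteq> 0" using assms(2) by simp
  ultimately have "2 * (b y (y - x) / q (y - x)) = 1"
    by simp
  then show ?thesis unfolding reflection_def by simp
qed

text \<open>If the composite \<open>\<rho>\<close> fixes \<open>S\<close> but moves
  \<open>x\<close>, one more reflection, along \<open>\<rho> x - x\<close>, sends
  \<open>\<rho> x\<close> back to \<open>x\<close>. That vector is orthogonal to \<open>S\<close>
  because \<open>\<rho>\<close> is an isometry fixing \<open>S\<close>, so nothing gained is lost;
  it is anisotropic because it is nonzero.\<close>

lemma Cartan_Dieudonne_fixing:
  assumes "finite S" "isometry \<sigma>"
  shows "\<exists>us. 0 \<notin> set us \<and> (\<forall>s \<in> S. (reflection_product us \<circ> \<sigma>) s = s)"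
  using assms(1)
proof induction
  case empty
  then show ?case by (intro exI[of _ "[]"]) simp
next
  case (insert x S)
  then obtain us where us: "0 \<notin> set us" "\<And>s. s \<in> S \<Longrightarrow> (reflection_product us \<circ> \<sigma>) s = s" by blast
  define \<rho> where "\<rho> = reflection_product us \<circ> \<sigma>"
  have \<rho>: "isometry \<rho>" unfolding \<rho>_def using us(1) assms(2)
    by (intro isometry_comp isometry_reflection_product)
  show ?case
  proof (cases "\<rho> x = x")
    case True
    then show ?thesis using us unfolding \<rho>_def by blast
  next
    case False
    let ?u = "\<rho> x - x"
    have "reflection ?u (\<rho> x) = x"
      using False q_isometry[OF \<rho>] by (intro reflection_diff_isometric) auto
    moreover have "reflection ?u (\<rho> s) = s" if s: "s \<in> S" for s
    proof -
      have "\<rho> s = s" using us(2)[OF s] by (simp add: \<rho>_def)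
      moreover have "b s ?u = 0"
        using form_isometry[OF \<rho>, of s x] \<open>\<rho> s = s\<close> by (simp add: form_diff_right)
      ultimately show ?thesis by (simp add: reflection_orthogonal)
    qed
    ultimately show ?thesis using us(1) False
      by (intro exI[of _ "?u # us"]) (auto simp: reflection_product_Cons \<rho>_def)
  qed
qed

text \<open>A composite fixing a finite spanning set is the identity; the reversed list then factors
  \<open>\<sigma>\<close>.\<close>

lemma Cartan_Dieudonne:
  assumes "isometry \<sigma>"
  obtains us where "0 \<notin> set us" "\<sigma> = reflection_product us"
proof -
  obtain B where B: "finite B" "span B = UNIV" using finite_dimensional by blast
  obtain us where us: "0 \<notin> set us" "\<And>s. s \<in> B \<Longrightarrow> (reflection_product us \<circ> \<sigma>) s = s"
    using Cartan_Dieudonne_fixing[OF B(1) assms] by blast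
  let ?\<rho> = "reflection_product us \<circ> \<sigma>"
  have \<rho>: "isometry ?\<rho>" using us(1) assms by (intro isometry_comp isometry_reflection_product)
  have "subspace {x. ?\<rho> x = x}"
    using isometry_linear[OF \<rho>] isometry_linear(2)[OF \<rho>, of 0 0]
    by (intro subspaceI) auto
  then have "span B \<subseteq> {x. ?\<rho> x = x}" using us(2) by (intro span_minimal) auto
  then have "?\<rho> = id" using B(2) by (auto simp: fun_eq_iff)
  then have "reflection_product (rev us) \<circ> ?\<rho> = reflection_product (rev us)" by simp
  then have "\<sigma> = reflection_product (rev us)"
    using reflection_product_rev[OF us(1)] by (simp flip: comp_assoc)
  then show thesis using us(1) by (intro that[of "rev us"]) simp_all
qed

text \<open>Factorizations are concatenated. Arbitrary representatives \<open>a\<close> and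
  \<open>c\<close> are allowed, which keeps later computations in the field.\<close>

lemma spinor_norm_comp:
  assumes "isometry \<sigma>" "isometry \<tau>"
    "spinor_norm \<sigma> = square_class a" "spinor_norm \<tau> = square_class c"
  shows "spinor_norm (\<sigma> \<circ> \<tau>) = square_class (a * c)"
proof -
  obtain us where us: "0 \<notin> set us" "\<sigma> = reflection_product us"
    using Cartan_Dieudonne assms(1) by blast
  obtain vs where vs: "0 \<notin> set vs" "\<tau> = reflection_product vs"
    using Cartan_Dieudonne assms(2) by blast
  obtain s where s: "s \<noteq> 0" "prod_list (map q us) = s\<^sup>2 * a"
    using assms(3) us by (auto simp: spinor_norm_reflection_product square_class_eq_iff)
  obtain t where t: "t \<noteq> 0" "prod_list (map q vs) = t\<^sup>2 * c"
    using assms(4) vs by (auto simp: spinor_norm_reflection_product square_class_eq_iff)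
  have "spinor_norm (\<sigma> \<circ> \<tau>) = square_class (prod_list (map q (us @ vs)))"
    using us vs spinor_norm_reflection_product[of "us @ vs"] by (simp add: reflection_product_append)
  also have "\<dots> = square_class (a * c)"
    unfolding square_class_eq_iff using s t
    by (intro exI[of _ "s * t"]) (simp add: power2_eq_square)
  finally show ?thesis .
qed

lemma spinor_norm_id: "spinor_norm id = square_class 1"
  using spinor_norm_reflection_product[of "[]"] by simp

lemma spinor_norm_exists:
  assumes "isometry \<sigma>"
  obtains a where "a \<noteq> 0" "spinor_norm \<sigma> = square_class a"
  using Cartan_Dieudonne[OF assms] spinor_norm_reflection_product prod_list_q_nonzero by metis

section \<open>Orthogonal bases and the spinor norm of \<open>uminus\<close>\<close>

lemma orthogonal_component:
  assumes "0 \<notin> S" "finite S" "\<And>x y. x \<in> S \<Longrightarrow> y \<in> S \<Longrightarrow> x \<noteq> y \<Longrightarrow> b x y = 0"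
    and "e \<in> S"
  shows "b (x - (\<Sum>d\<in>S. (b x d / q d) *s d)) e = 0"
proof -
  have "b (\<Sum>d\<in>S. (b x d / q d) *s d) e = (\<Sum>d\<in>S. if d = e then b x e else 0)"
    unfolding form_sum_left using assms
    by (intro sum.cong) (auto simp: form_scale_left)
  then show ?thesis using assms(2,4) by (simp add: form_diff_left)
qed

text \<open>Gram-Schmidt without normalization; anisotropy keeps all denominators nonzero.\<close>

lemma orthogonal_spanning_list:
  assumes "finite S"
  shows "\<exists>es. 0 \<notin> set es \<and> distinct es \<and> (\<forall>x \<in> set es. \<forall>y \<in> set es. x \<noteq> y \<longrightarrow> b x y = 0) \<and>
    span (set es) = span S"
  using assms
proof induction
  case empty
  then show ?case by (intro exI[of _ "[]"]) simp
next
  case (insert x S)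
  then obtain es where es: "0 \<notin> set es" "distinct es"
    "\<And>x y. x \<in> set es \<Longrightarrow> y \<in> set es \<Longrightarrow> x \<noteq> y \<Longrightarrow> b x y = 0"
    "span (set es) = span S" by blast
  define p where "p = (\<Sum>e\<in>set es. (b x e / q e) *s e)"
  define y where "y = x - p"
  have p: "p \<in> span (set es)" unfolding p_def by (intro span_sum span_scale span_base)
  have orth: "b y e = 0" if "e \<in> set es" for e
    unfolding y_def p_def using es(1,3) that by (intro orthogonal_component) auto
  have span_y: "span (insert y (set es)) = span (insert x S)"
  proof -
    have "span (insert y (set es)) = span (insert x (set es))"
      using p by (intro eq_span_insert_eq) (simp add: y_def span_neg)
    also have "\<dots> = span (insert x S)"
      by (simp add: span_insert es(4))
    finally show ?thesis .
  qed
  show ?case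
  \<comment> \<open>A zero residual means that \<open>x\<close> was already in the span, and it is
    dropped to keep zero out of the list.\<close>
  proof (cases "y = 0")
    case True
    then have "span (set es) = span (insert x S)" using span_y by simp
    then show ?thesis using es by blast
  next
    case False
    have "y \<notin> set es" using orth[of y] False by auto
    then show ?thesis using es orth span_y False
      by (intro exI[of _ "y # es"]) (auto simp: form_sym[of _ y])
  qed
qed

text \<open>Pairing a linear relation with \<open>x\<close> isolates
  \<open>f x * q x\<close>.\<close>

lemma independent_orthogonal:
  assumes "0 \<notin> S" "finite S" "\<And>x y. x \<in> S \<Longrightarrow> y \<in> S \<Longrightarrow> x \<noteq> y \<Longrightarrow> b x y = 0"
  shows "independent S"
proof (rule independent_if_scalars_zero)
  fix f x assume sum0: "(\<Sum>x\<in>S. f x *s x) = 0" and x: "x \<in> S"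
  have "0 = b (\<Sum>y\<in>S. f y *s y) x" using sum0 by simp
  also have "\<dots> = (\<Sum>y\<in>S. if y = x then f x * q x else 0)"
    unfolding form_sum_left using assms(3) x by (intro sum.cong) (auto simp: form_scale_left)
  also have "\<dots> = f x * q x" using x assms(2) by simp
  finally show "f x = 0" using x assms(1) by auto
qed (fact assms(2))

lemma orthogonal_basis:
  obtains es where "ordered_basis es" "0 \<notin> set es"
    "\<And>x y. x \<in> set es \<Longrightarrow> y \<in> set es \<Longrightarrow> x \<noteq> y \<Longrightarrow> b x y = 0"
proof -
  obtain B where B: "finite B" "span B = UNIV" using finite_dimensional by blast
  show thesis
    using orthogonal_spanning_list[OF B(1)] B(2) that independent_orthogonal
    unfolding ordered_basis_def by (metis List.finite_set)
qed

text \<open>The claims share one induction: for \<open>x\<close> equal to the head, the first claim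
  uses the second on the tail, which is orthogonal to \<open>x\<close>.\<close>

lemma reflection_product_orthogonal:
  assumes "0 \<notin> set es" "distinct es"
    "\<And>x y. x \<in> set es \<Longrightarrow> y \<in> set es \<Longrightarrow> x \<noteq> y \<Longrightarrow> b x y = 0"
  shows "x \<in> set es \<Longrightarrow> reflection_product es x = - x"
    and "(\<And>e. e \<in> set es \<Longrightarrow> b x e = 0) \<Longrightarrow> reflection_product es x = x"
  using assms
proof (induction es arbitrary: x)
  case (Cons e es)
  {
    case 1
    show ?case
    proof (cases "x = e")
      case True
      then have "reflection_product es x = x" using 1 by (intro Cons.IH) auto
      then show ?thesis using True by (simp add: reflection_product_Cons reflection_self)
    next
      case False
      then have "reflection_product es x = - x" using 1 by (intro Cons.IH) auto
      moreover have "b x e = 0" using 1 False by auto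
      ultimately show ?thesis
        by (simp add: reflection_product_Cons reflection_orthogonal form_minus_left)
    qed
  next
    case 2
    then have "reflection_product es x = x" by (intro Cons.IH) auto
    then show ?case using 2 by (simp add: reflection_product_Cons reflection_orthogonal)
  }
qed simp_all

lemma reflection_product_orthogonal_basis:
  assumes "ordered_basis es" "0 \<notin> set es"
    "\<And>x y. x \<in> set es \<Longrightarrow> y \<in> set es \<Longrightarrow> x \<noteq> y \<Longrightarrow> b x y = 0"
  shows "reflection_product es = uminus"
proof -
  let ?\<rho> = "reflection_product es"
  have \<rho>: "isometry ?\<rho>" using assms(2) by (rule isometry_reflection_product)
  have "subspace {x. ?\<rho> x = - x}"
    using isometry_linear[OF \<rho>] isometry_linear(2)[OF \<rho>, of 0 0]
    by (intro subspaceI) auto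
  moreover have "set es \<subseteq> {x. ?\<rho> x = - x}"
    using assms reflection_product_orthogonal(1)[of es] by (auto simp: ordered_basis_def)
  ultimately have "span (set es) \<subseteq> {x. ?\<rho> x = - x}" by (intro span_minimal)
  then show ?thesis using assms(1) by (auto simp: ordered_basis_def fun_eq_iff)
qed

text \<open>For an orthogonal basis, the product of the \<open>q\<close>-values is at once a spinor
  norm representative and the determinant of a diagonal Gram matrix.\<close>

lemma spinor_norm_uminus: "spinor_norm uminus = form_det"
proof -
  obtain es where es: "ordered_basis es" "0 \<notin> set es"
    "\<And>x y. x \<in> set es \<Longrightarrow> y \<in> set es \<Longrightarrow> x \<noteq> y \<Longrightarrow> b x y = 0"
    using orthogonal_basis by blast
  have "spinor_norm uminus = square_class (prod_list (map q es))"
    using spinor_norm_reflection_product[OF es(2)] reflection_product_orthogonal_basis[OF es]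
    by simp
  also have "prod_list (map q es) = det (gram_matrix es)"
    using es(1,3) by (simp add: det_gram_matrix_orthogonal ordered_basis_def)
  finally show ?thesis using form_det_eq[OF es(1)] by simp
qed

section \<open>Determinants and rotations\<close>

text \<open>In a basis starting with \<open>u\<close>, the matrix differs from the identity only in
  its first row, so it is upper triangular with diagonal \<open>- 1, 1, ..., 1\<close>.\<close>

lemma endo_det_reflection:
  assumes u: "u \<noteq> 0"
  shows "endo_det (reflection u) = - 1"
proof -
  have "independent {u}" using u by simp
  then obtain ws where ws: "ordered_basis ws" "u \<in> set ws"
    using ordered_basis_extend by (metis insert_subset)
  define vs where "vs = u # remove1 u ws"
  have vs: "ordered_basis vs"
    using ws by (auto simp: ordered_basis_def vs_def insert_absorb)
  let ?A = "rep_matrix vs vs (reflection u)" and ?n = "length vs"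
  have A: "?A \<in> carrier_mat ?n ?n" by (simp add: rep_matrix_def)
  have indep: "independent (set vs)" "span (set vs) = UNIV" and dist: "distinct vs"
    using vs by (simp_all add: ordered_basis_def)
  have entry: "?A $$ (i, j) = (if i = j then 1 else 0) - 2 * (b (vs ! j) u / q u) * (if i = 0 then 1 else 0)"
    if "i < ?n" "j < ?n" for i j
  proof -
    have "representation (set vs) (vs ! j) (vs ! i) = (if i = j then 1 else 0)"
      using that dist by (simp add: representation_basis[OF indep(1)] nth_eq_iff_index_eq eq_commute)
    moreover have "representation (set vs) u (vs ! i) = (if i = 0 then 1 else 0)"
    proof -
      have u0: "u = vs ! 0" "0 < ?n" by (simp_all add: vs_def)
      then have "representation (set vs) u = (\<lambda>v. if v = u then 1 else 0)"
        by (intro representation_basis indep(1)) (simp add: vs_def)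
      then show ?thesis using that(1) dist u0 by (simp add: nth_eq_iff_index_eq)
    qed
    ultimately show ?thesis
      using that indep
      by (simp add: rep_matrix_def reflection_def representation_diff representation_scale)
  qed
  have "upper_triangular ?A"
    using A entry by (intro upper_triangularI) auto
  then have "det ?A = prod_list (diag_mat ?A)" using A by (rule det_upper_triangular)
  also have "diag_mat ?A = map (\<lambda>i. if i = 0 then - 1 else 1) [0..<?n]"
    using A entry u by (auto simp: diag_mat_def vs_def)
  also have "\<dots> = - 1 # map (\<lambda>i. 1) [0..<length (remove1 u ws)]"
    by (simp add: vs_def upt_conv_Cons map_Suc_upt[symmetric] del: upt_Suc)
  also have "prod_list \<dots> = - 1" by (simp add: map_replicate_const)
  finally show ?thesis using endo_det_eq[OF linear_reflection vs] by simp
qed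

lemma rotation_group_simps:
  "\<sigma> \<in> carrier rotation_group \<longleftrightarrow> isometry \<sigma> \<and> endo_det \<sigma> = 1"
  "\<sigma> \<otimes>\<^bsub>rotation_group\<^esub> \<tau> = \<sigma> \<circ> \<tau>"
  "\<one>\<^bsub>rotation_group\<^esub> = id"
  by (simp_all add: rotation_group_def orthogonal_group_def)

text \<open>Supplies the rotations with which a central element is compared.\<close>

lemma reflection_pair_rotation:
  assumes "u \<noteq> 0" "v \<noteq> 0"
  shows "reflection u \<circ> reflection v \<in> carrier rotation_group"
  using assms
  by (simp add: rotation_group_simps isometry_comp isometry_reflection endo_det_comp
      linear_reflection endo_det_reflection)

lemma uminus_rotation_iff: "uminus \<in> carrier rotation_group \<longleftrightarrow> even (dim UNIV)"
proof -
  have "isometry uminus"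
    unfolding isometry_def by (simp add: linear_uminus form_simps bij_uminus)
  moreover have "(- 1 :: 'f) \<noteq> 1"
    using two_nonzero by (metis neg_eq_iff_add_eq_0 one_add_one)
  ultimately show ?thesis
    by (cases "even (dim UNIV)") (simp_all add: rotation_group_simps endo_det_uminus)
qed

section \<open>The center of the rotation group\<close>

text \<open>By dimension \<open>S\<close> does not span. The Gram-Schmidt residual of a vector
  outside the span is nonzero and orthogonal to all of the span.\<close>

lemma exists_orthogonal:
  assumes "finite S" "card S < dim UNIV"
  obtains w where "w \<noteq> 0" "\<And>s. s \<in> S \<Longrightarrow> b s w = 0"
proof -
  obtain es where es: "0 \<notin> set es" "distinct es"
    "\<And>x y. x \<in> set es \<Longrightarrow> y \<in> set es \<Longrightarrow> x \<noteq> y \<Longrightarrow> b x y = 0" "span (set es) = span S"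
    using orthogonal_spanning_list[OF assms(1)] by blast
  have "span S \<noteq> UNIV" using dim_le_card[of UNIV S] assms by auto
  then obtain x where x: "x \<notin> span (set es)" using es(4) by blast
  let ?w = "x - (\<Sum>e\<in>set es. (b x e / q e) *s e)"
  have "?w \<noteq> 0"
  proof
    assume "?w = 0"
    then have "x = (\<Sum>e\<in>set es. (b x e / q e) *s e)" by simp
    moreover have "\<dots> \<in> span (set es)" by (intro span_sum span_scale span_base)
    ultimately show False using x by simp
  qed
  moreover have "b s ?w = 0" if s: "s \<in> S" for s
  proof -
    have "b ?w e = 0" if "e \<in> set es" for e
      using es(1,3) that by (intro orthogonal_component) auto
    then have "set es \<subseteq> {y. b y ?w = 0}" by (auto simp: form_sym[of _ ?w])
    moreover have "subspace {y. b y ?w = 0}"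
      by (intro subspaceI) (simp_all add: form_add_left form_scale_left)
    ultimately have "span (set es) \<subseteq> {y. b y ?w = 0}" by (rule span_minimal)
    then show ?thesis using s es(4) span_base by blast
  qed
  ultimately show thesis by (rule that)
qed

text \<open>
  A central rotation preserves every plane spanned by orthogonal \<open>u\<close>, \<open>v\<close>, because that plane is
  the \<open>-1\<close>-eigenspace of the product of the reflections along \<open>u\<close> and \<open>v\<close>.
\<close>

lemma rotation_center_preserves_plane:
  assumes z: "z \<in> group_center rotation_group" and "u \<noteq> 0" "w \<noteq> 0" "b u w = 0"
  shows "z u \<in> span {u, w}"
proof -
  let ?f = "reflection u \<circ> reflection w" and ?y = "z u"
  have zi: "isometry z" using z by (simp add: group_center_def rotation_group_simps)
  have "z \<circ> ?f = ?f \<circ> z"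
    using z reflection_pair_rotation[OF assms(2,3)]
    unfolding group_center_def rotation_group_simps(2) by blast
  then have "z (?f u) = ?f ?y" by (metis comp_apply)
  moreover have "?f u = - u" using assms(4) by (simp add: reflection_orthogonal reflection_self)
  moreover have "z (- u) = - ?y" using isometry_linear(2)[OF zi, of "-1" u] by simp
  ultimately have "- ?y = ?f ?y" by simp
  \<comment> \<open>Written out, this equation expresses \<open>?y + ?y\<close> through
    \<open>u\<close> and \<open>w\<close>.\<close>
  also have "\<dots> = ?y - (2 * (b ?y w / q w)) *s w - (2 * (b ?y u / q u)) *s u"
    using assms(4) by (simp add: reflection_def form_diff_left form_scale_left form_sym[of w u])
  finally have "?y + ?y = ?y - (?y - (2 * (b ?y w / q w)) *s w - (2 * (b ?y u / q u)) *s u)"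
    by (metis diff_minus_eq_add)
  also have "\<dots> = (2 * (b ?y w / q w)) *s w + (2 * (b ?y u / q u)) *s u" by simp
  also have "\<dots> \<in> span {u, w}" by (intro span_add span_scale span_base) simp_all
  finally show ?thesis by (rule mem_span_doubleD)
qed

text \<open>Let \<open>v\<close> be the component of \<open>z u\<close> orthogonal to
  \<open>u\<close>. In dimension at least three some nonzero \<open>w\<close> is orthogonal to
  \<open>u\<close> and \<open>v\<close>. The plane of \<open>u\<close> and \<open>w\<close> is
  preserved in the sense that it contains \<open>z u\<close>, so it contains \<open>v\<close>; but
  \<open>v\<close> is orthogonal to that plane, hence zero by anisotropy.\<close>

lemma rotation_center_preserves_line:
  assumes z: "z \<in> group_center rotation_group" and u: "u \<noteq> 0" and "dim UNIV \<ge> 3"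
  obtains c where "z u = c *s u"
proof -
  define c v where "c = b (z u) u / q u" and "v = z u - c *s u"
  have uv: "b u v = 0"
    using u by (simp add: v_def c_def form_diff_right form_scale_right form_sym[of u "z u"])
  have "card {u, v} < dim UNIV" using assms(3) card_insert_le_m1[of 2 "{v}" u] by simp
  then obtain w where "w \<noteq> 0" "\<And>s. s \<in> {u, v} \<Longrightarrow> b s w = 0"
    by (rule exists_orthogonal[OF finite.insertI[OF finite.insertI[OF finite.emptyI]]]) blast
  then have w: "w \<noteq> 0" "b u w = 0" "b v w = 0" by simp_all
  have "v \<in> span {u, w}"
    unfolding v_def
    using rotation_center_preserves_plane[OF z u w(1,2)] span_scale[OF span_base[of u]]
    by (intro span_diff) simp_all
  moreover have "subspace {y. b y v = 0}"
    by (intro subspaceI) (simp_all add: form_add_left form_scale_left)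
  moreover have "{u, w} \<subseteq> {y. b y v = 0}" using uv w(3) by (simp add: form_sym[of w])
  ultimately have "v \<in> {y. b y v = 0}" using span_minimal by blast
  then have "v = 0" by simp
  then show thesis using that[of c] by (simp add: v_def)
qed

text \<open>Every vector is an eigenvector, and invariance of \<open>q\<close> makes each eigenvalue
  \<open>1\<close> or \<open>- 1\<close>. Vectors \<open>u\<close>, \<open>v\<close> with different
  signs are excluded by looking at \<open>u + v\<close>.\<close>

lemma rotation_group_center:
  assumes z: "z \<in> group_center rotation_group" and "dim UNIV \<ge> 3"
  shows "z = id \<or> z = uminus"
proof (rule ccontr)
  have zi: "isometry z" using z by (simp add: group_center_def rotation_group_simps)
  have sign: "z u = u \<or> z u = - u" if u: "u \<noteq> 0" for u
  proof -
    obtain c where c: "z u = c *s u" using rotation_center_preserves_line[OF z u assms(2)] .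
    then have "c\<^sup>2 * q u = 1 * q u" using q_isometry[OF zi, of u] by (simp add: q_scale)
    then have "c\<^sup>2 = 1" using u by simp
    then show ?thesis using c by (auto simp: power2_eq_1_iff)
  qed
  have z0: "z 0 = 0" using isometry_linear(2)[OF zi, of 0 0] by simp
  have nonzero_double: "x + x \<noteq> 0" if "x \<noteq> 0" for x :: 'v
    using that two_nonzero by (simp flip: double)
  assume "\<not> (z = id \<or> z = uminus)"
  then obtain u v where uv: "z u \<noteq> u" "z v \<noteq> - v" by (auto simp: fun_eq_iff)
  then have "u \<noteq> 0" "v \<noteq> 0" using z0 by auto
  then have zuv: "z u = - u" "z v = v" using uv sign by blast+
  have "u + v \<noteq> 0"
  proof
    assume "u + v = 0"
    then have "v = - u" by (simp add: eq_neg_iff_add_eq_0 add.commute)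
    moreover have "z (- u) = - z u" using isometry_linear(2)[OF zi, of "-1" u] by simp
    ultimately show False using zuv uv by simp
  qed
  \<comment> \<open>Either sign for \<open>u + v\<close> makes \<open>u + u\<close> or
    \<open>v + v\<close> vanish.\<close>
  then have "- u + v = u + v \<or> - u + v = - (u + v)"
    using sign[of "u + v"] isometry_linear(1)[OF zi] zuv by simp
  then have "u + u = 0 \<or> v + v = 0" by (auto simp: algebra_simps add_eq_0_iff)
  then show False using nonzero_double \<open>u \<noteq> 0\<close> \<open>v \<noteq> 0\<close> by blast
qed

section \<open>Triviality of the spinor norm\<close>

definition spinor_kernel :: "('v \<Rightarrow> 'v) set" where
  "spinor_kernel = {\<sigma> \<in> carrier rotation_group. spinor_norm \<sigma> = square_class 1}"

text \<open>The group property assumed here is later supplied by projective simplicity, whose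
  definition includes it.\<close>

context
  assumes group_rotations: "group rotation_group"
begin

interpretation SO: group rotation_group by (fact group_rotations)

lemma spinor_norm_mult:
  assumes "\<sigma> \<in> carrier rotation_group" "\<tau> \<in> carrier rotation_group"
    "spinor_norm \<sigma> = square_class a" "spinor_norm \<tau> = square_class c"
  shows "spinor_norm (\<sigma> \<otimes>\<^bsub>rotation_group\<^esub> \<tau>) = square_class (a * c)"
  using assms spinor_norm_comp by (simp add: rotation_group_simps)

text \<open>Multiplicativity is applied to \<open>\<sigma>\<close> and its inverse, whose product
  has trivial spinor norm. The square witness serves conjugates and commutators alike.\<close>

lemma spinor_norm_inv:
  assumes \<sigma>: "\<sigma> \<in> carrier rotation_group"
  obtains a a' t where "spinor_norm \<sigma> = square_class a"
    "spinor_norm (inv\<^bsub>rotation_group\<^esub> \<sigma>) = square_class a'" "t \<noteq> 0" "a * a' = t\<^sup>2"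
proof -
  have \<sigma>': "inv\<^bsub>rotation_group\<^esub> \<sigma> \<in> carrier rotation_group" using \<sigma> by simp
  obtain a where a: "spinor_norm \<sigma> = square_class a"
    using spinor_norm_exists \<sigma> by (metis rotation_group_simps(1))
  obtain a' where a': "spinor_norm (inv\<^bsub>rotation_group\<^esub> \<sigma>) = square_class a'"
    using spinor_norm_exists \<sigma>' by (metis rotation_group_simps(1))
  have "square_class (a * a') = square_class 1"
    using spinor_norm_mult[OF \<sigma> \<sigma>' a a'] \<sigma> spinor_norm_id
    by (simp add: rotation_group_simps(3))
  then obtain t where "t \<noteq> 0" "a * a' = t\<^sup>2" by (auto simp: square_class_eq_iff)
  then show thesis using that a a' by blast
qed

lemma spinor_kernel_normal: "spinor_kernel \<lhd> rotation_group"
proof (rule SO.normal_invI)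
  show "subgroup spinor_kernel rotation_group"
  proof (rule SO.subgroupI)
    have "id \<in> spinor_kernel"
      using SO.one_closed by (simp add: spinor_kernel_def spinor_norm_id rotation_group_simps(3))
    then show "spinor_kernel \<noteq> {}" by blast
  next
    fix \<sigma> assume \<sigma>: "\<sigma> \<in> spinor_kernel"
    then have \<sigma>c: "\<sigma> \<in> carrier rotation_group" by (simp add: spinor_kernel_def)
    obtain a a' t where a: "spinor_norm \<sigma> = square_class a"
      "spinor_norm (inv\<^bsub>rotation_group\<^esub> \<sigma>) = square_class a'" "t \<noteq> 0" "a * a' = t\<^sup>2"
      using spinor_norm_inv[OF \<sigma>c] .
    have "spinor_norm \<one>\<^bsub>rotation_group\<^esub> = square_class (1 * a')"
      using spinor_norm_mult[OF \<sigma>c SO.inv_closed[OF \<sigma>c] _ a(2), of 1] \<sigma> \<sigma>c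
      by (simp add: spinor_kernel_def)
    then show "inv\<^bsub>rotation_group\<^esub> \<sigma> \<in> spinor_kernel"
      using a(2) \<sigma>c by (simp add: spinor_kernel_def rotation_group_simps(3) spinor_norm_id)
  next
    fix \<sigma> \<tau> assume "\<sigma> \<in> spinor_kernel" "\<tau> \<in> spinor_kernel"
    then show "\<sigma> \<otimes>\<^bsub>rotation_group\<^esub> \<tau> \<in> spinor_kernel"
      using spinor_norm_mult[of \<sigma> \<tau> 1 1] by (simp add: spinor_kernel_def)
  qed (auto simp: spinor_kernel_def)
next
  fix \<sigma> \<kappa> assume \<sigma>: "\<sigma> \<in> carrier rotation_group" and \<kappa>: "\<kappa> \<in> spinor_kernel"
  obtain a a' t where a: "spinor_norm \<sigma> = square_class a"
    "spinor_norm (inv\<^bsub>rotation_group\<^esub> \<sigma>) = square_class a'" "t \<noteq> 0" "a * a' = t\<^sup>2"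
    using spinor_norm_inv[OF \<sigma>] .
  have "spinor_norm (\<sigma> \<otimes>\<^bsub>rotation_group\<^esub> \<kappa> \<otimes>\<^bsub>rotation_group\<^esub> inv\<^bsub>rotation_group\<^esub> \<sigma>)
    = square_class (a * 1 * a')"
    using \<sigma> \<kappa> a(1,2) by (intro spinor_norm_mult) (auto simp: spinor_kernel_def)
  also have "\<dots> = square_class 1" using a(3,4) by (auto simp: square_class_eq_iff)
  finally show "\<sigma> \<otimes>\<^bsub>rotation_group\<^esub> \<kappa> \<otimes>\<^bsub>rotation_group\<^esub> inv\<^bsub>rotation_group\<^esub> \<sigma> \<in> spinor_kernel"
    using \<sigma> \<kappa> by (auto simp: spinor_kernel_def)
qed

text \<open>Field multiplication commutes, so the representatives regroup into \<open>a * a'\<close>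
  and \<open>c * c'\<close>, both squares.\<close>

lemma commutator_mem_spinor_kernel:
  assumes \<sigma>: "\<sigma> \<in> carrier rotation_group" and \<tau>: "\<tau> \<in> carrier rotation_group"
  shows "\<sigma> \<otimes>\<^bsub>rotation_group\<^esub> \<tau> \<otimes>\<^bsub>rotation_group\<^esub> inv\<^bsub>rotation_group\<^esub> \<sigma>
    \<otimes>\<^bsub>rotation_group\<^esub> inv\<^bsub>rotation_group\<^esub> \<tau> \<in> spinor_kernel" (is "?x \<in> _")
proof -
  obtain a a' s where a: "spinor_norm \<sigma> = square_class a"
    "spinor_norm (inv\<^bsub>rotation_group\<^esub> \<sigma>) = square_class a'" "s \<noteq> 0" "a * a' = s\<^sup>2"
    using spinor_norm_inv[OF \<sigma>] .
  obtain c c' t where c: "spinor_norm \<tau> = square_class c"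
    "spinor_norm (inv\<^bsub>rotation_group\<^esub> \<tau>) = square_class c'" "t \<noteq> 0" "c * c' = t\<^sup>2"
    using spinor_norm_inv[OF \<tau>] .
  have "spinor_norm ?x = square_class (a * c * a' * c')"
    using assms a(1,2) c(1,2) by (intro spinor_norm_mult) auto
  moreover have "a * c * a' * c' = (s * t)\<^sup>2 * 1"
  proof -
    have "a * c * a' * c' = (a * a') * (c * c')" by (simp only: mult_ac)
    then show ?thesis by (simp add: a(4) c(4) power_mult_distrib)
  qed
  ultimately have "spinor_norm ?x = square_class 1"
    using a(3) c(3) unfolding square_class_eq_iff by (metis mult_eq_0_iff square_class_eq_iff)
  then show ?thesis using assms by (simp add: spinor_kernel_def)
qed

end

section \<open>The equivalence, by reduction to the center\<close>

theorem spinor_norm_trivial_iff: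
  assumes n: "dim UNIV \<ge> 3" and ps: "projectively_simple rotation_group"
  shows "(\<forall>\<sigma> \<in> carrier rotation_group. spinor_norm \<sigma> = square_class 1) \<longleftrightarrow>
    odd (dim UNIV) \<or> form_det = square_class 1"
proof
  assume "\<forall>\<sigma> \<in> carrier rotation_group. spinor_norm \<sigma> = square_class 1"
  then show "odd (dim UNIV) \<or> form_det = square_class 1"
    using uminus_rotation_iff spinor_norm_uminus by metis
next
  assume cases: "odd (dim UNIV) \<or> form_det = square_class 1"
  have G: "group rotation_group" using ps by (simp add: projectively_simple_def)
  show "\<forall>\<sigma> \<in> carrier rotation_group. spinor_norm \<sigma> = square_class 1"
  proof
    fix \<sigma> assume "\<sigma> \<in> carrier rotation_group"
    then obtain z \<kappa> where z: "z \<in> group_center rotation_group" and \<kappa>: "\<kappa> \<in> spinor_kernel"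
      and \<sigma>: "\<sigma> = z \<otimes>\<^bsub>rotation_group\<^esub> \<kappa>"
      using projectively_simple_factorization[OF ps spinor_kernel_normal[OF G]
          commutator_mem_spinor_kernel[OF G]] by blast
    have zc: "z \<in> carrier rotation_group" using z by (simp add: group_center_def)
    have "spinor_norm z = square_class 1"
      using rotation_group_center[OF z n]
    proof
      assume "z = id"
      then show ?thesis by (simp only: spinor_norm_id)
    next
      assume z: "z = uminus"
      \<comment> \<open>\<open>uminus\<close> occurs as a rotation only in even dimension, so the
        remaining alternative is a trivial determinant.\<close>
      then have "even (dim UNIV)" using zc uminus_rotation_iff by metis
      then show ?thesis using cases z spinor_norm_uminus by metis
    qed
    then show "spinor_norm \<sigma> = square_class 1"
      using spinor_norm_mult[OF G zc, of \<kappa> 1 1] \<kappa> \<sigma> by (simp add: spinor_kernel_def)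
  qed
qed

end

theorem proposition3p2:
  fixes scale :: "'f::field \<Rightarrow> 'v::ab_group_add \<Rightarrow> 'v"
    and b :: "'v \<Rightarrow> 'v \<Rightarrow> 'f"
    and n :: nat
  assumes "CHAR('f) \<noteq> 2"
    and "bilinear_space scale b"
    and "bilinear_space.anisotropic b"
    and "n = vector_space.dim scale UNIV"
    and "n \<ge> 3"
    and "projectively_simple (bilinear_space.rotation_group scale b)"
  shows "(\<forall>\<sigma> \<in> carrier (bilinear_space.rotation_group scale b).
            bilinear_space.spinor_norm scale b \<sigma> = \<one>\<^bsub>square_class_group\<^esub>) \<longleftrightarrow>
         odd n \<or> (even n \<and> bilinear_space.form_det scale b = \<one>\<^bsub>square_class_group\<^esub>)"
proof -
  have "(2::'f) \<noteq> 0"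
  proof
    assume "(2::'f) = 0"
    \<comment> \<open>A characteristic dividing the prime \<open>2\<close> is \<open>1\<close> or
      \<open>2\<close>; a field excludes the former and the hypothesis the latter.\<close>
    then have "CHAR('f) dvd 2" using of_nat_eq_0_iff_char_dvd[of 2, where ?'a = 'f] by simp
    then have "CHAR('f) = 1 \<or> CHAR('f) = 2" using two_is_prime_nat prime_nat_iff by blast
    then show False using assms(1) CHAR_not_1 by auto
  qed
  then interpret anisotropic_space scale b
    using assms(2,3) by (simp add: anisotropic_space_def anisotropic_space_axioms_def)
  have "\<one>\<^bsub>square_class_group\<^esub> = square_class (1::'f)"
    using square_class_eq_one_iff[of "1::'f"] by (metis one_power2 zero_neq_one)
  then show ?thesis
    using spinor_norm_trivial_iff assms(4-6) by auto
qed

end
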